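(* Let $N$ and $p$ be integers such that $0 \le p < \frac{N}{2}$. Then: \begin{itemize} \item $N- \left\lfloor \frac{N}{p+1} \right\rfloor \le Q(N,p, \le) \le N+1-\left\lfloor \frac{N+1}{p+1} \right\rfloor$; \item $Q(N,p, \le) = N +1- \left\lfloor \frac{N+1}{p+1} \right\rfloor$ whenever $N \equiv r \pmod{p+1}$ with $r=p$ or $0 \le r \le \left\lfloor \frac{p}{2} \right\rfloor$. \end{itemize}
   Context: There are $N$ balls $b_1,\dots,b_N$, each colored red or green, with strictly fewer green than red balls (a Red-green coloring). For an integer $0\le p<\frac N2$, the coloring is $p$-majored if at most $p$ balls are green. A comparison consists of choosing two balls and being told whether or not they have the same color (only "same" or "different" is answered). A method is an adaptive deterministic strategy: each comparison may depend on the answers to the previous ones. $Q(N,p,\le)$ is the minimum integer $k$ such that there exists a method which, for every $p$-majored Red-green coloring of the $N$ balls (it being known in advance that the coloring is $p$-majored), determines for sure the color of every ball after at most $k$ comparisons. *)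

theory Defs
  imports Complex_Main "HOL-Number_Theory.Cong"
begin

datatype color = Red | Green

text \<open>The balls are the numbers in \<open>{1..N}\<close>; the values of a coloring outside this set are
  irrelevant.\<close>

definition green_balls :: "nat \<Rightarrow> (nat \<Rightarrow> color) \<Rightarrow> nat set" where
  "green_balls N c = {b \<in> {1..N}. c b = Green}"

definition red_balls :: "nat \<Rightarrow> (nat \<Rightarrow> color) \<Rightarrow> nat set" where
  "red_balls N c = {b \<in> {1..N}. c b = Red}"

definition red_green_coloring :: "nat \<Rightarrow> (nat \<Rightarrow> color) \<Rightarrow> bool" where
  "red_green_coloring N c \<longleftrightarrow> card (green_balls N c) < card (red_balls N c)"

definition majored :: "nat \<Rightarrow> nat \<Rightarrow> (nat \<Rightarrow> color) \<Rightarrow> bool" where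
  "majored N p c \<longleftrightarrow> red_green_coloring N c \<and> card (green_balls N c) \<le> p"

text \<open>An adaptive deterministic strategy is a binary decision tree.  At a node \<open>Compare i j s d\<close> the
  balls \<open>i\<close> and \<open>j\<close> are compared, and the strategy continues with \<open>s\<close> if the answer is ``same'' and
  with \<open>d\<close> if the answer is ``different''; at a leaf it announces a coloring.\<close>

datatype strategy = Announce "nat \<Rightarrow> color" | Compare nat nat strategy strategy

fun valid_strategy :: "nat \<Rightarrow> strategy \<Rightarrow> bool" where
  "valid_strategy N (Announce f) \<longleftrightarrow> True"
| "valid_strategy N (Compare i j s d) \<longleftrightarrow>
     i \<in> {1..N} \<and> j \<in> {1..N} \<and> i \<noteq> j \<and> valid_strategy N s \<and> valid_strategy N d"

fun announced :: "strategy \<Rightarrow> (nat \<Rightarrow> color) \<Rightarrow> nat \<Rightarrow> color" where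
  "announced (Announce f) c = f"
| "announced (Compare i j s d) c = (if c i = c j then announced s c else announced d c)"

fun comparisons :: "strategy \<Rightarrow> (nat \<Rightarrow> color) \<Rightarrow> nat" where
  "comparisons (Announce f) c = 0"
| "comparisons (Compare i j s d) c = Suc (if c i = c j then comparisons s c else comparisons d c)"

definition solves :: "nat \<Rightarrow> nat \<Rightarrow> nat \<Rightarrow> strategy \<Rightarrow> bool" where
  "solves N p k t \<longleftrightarrow> valid_strategy N t \<and>
     (\<forall>c. majored N p c \<longrightarrow> comparisons t c \<le> k \<and> (\<forall>b\<in>{1..N}. announced t c b = c b))"

text \<open>For \<open>2 * p < N\<close> a solving strategy exists (compare ball 1 with all the others), so the minimum is
  over a nonempty set.\<close>

definition Q :: "nat \<Rightarrow> nat \<Rightarrow> nat" where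
  "Q N p = (LEAST k. \<exists>t. solves N p k t)"

end

theory Submission
  imports Defs "HOL-Library.Disjoint_Sets"
begin

text \<open>
  The comparisons made so far join the balls to components; inside a component with colour classes
  of sizes \<open>a \<ge> b\<close> only a global swap is undecided.  A comparison joining two components costs one,
  so everything is about how many components may be left when all colours are known.

  \<^emph>\<open>Upper bound.\<close>  Let \<open>q\<close> be the quotient of \<open>N + 1\<close> by \<open>p + 1\<close>; it suffices to finish with
  \<open>q - 1\<close> components.  Compare fresh balls with one growing component until one of its classes has
  \<open>p + 1\<close> balls.  That class must be red; if the other class has \<open>y\<close> balls, these are green, and the
  remaining balls contain at most \<open>p - y\<close> green ones.  The component has used \<open>p + 1 + y\<close> balls, and
  for the new bound \<open>p - y\<close> the remaining balls still suffice for \<open>q - 2\<close> components.  The last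
  component takes all balls that are left and is decided because red is the majority
  (\<open>solvable_growing_component\<close>).

  \<^emph>\<open>General lower bound.\<close>  An adversary who claims that all balls are red leaves every component of
  at most \<open>p\<close> balls undecided, because it could be entirely green.  So there are at most
  \<open>N div (p + 1)\<close> components in the end (\<open>forces_block_unions\<close>).

  \<^emph>\<open>Small remainder.\<close>  Let \<open>N = q (p + 1) + r\<close> with \<open>2 r \<le> p\<close>.  The adversary gains one more
  comparison by watching for the moment when the last component exceeds \<open>p\<close> balls.  It comes from
  merging \<open>X\<close> and \<open>Y\<close>, both of size at most \<open>p\<close>, and now the answer is ``different''.  Since the
  remaining undecided balls are so few, all of them can be added to the smaller of the two classes
  without exceeding \<open>p\<close>.  Hence this component stays undecided until it is compared with a ball of
  known colour, and so it never counts as a component of its own (\<open>forces_opposite_pair\<close>,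
  \<open>forces_block_unions_small_remainder\<close>).

  For \<open>r = p\<close> the upper bound and the general lower bound coincide.
\<close>

section \<open>Forcing comparisons\<close>

definition coloring_of :: "nat set \<Rightarrow> nat \<Rightarrow> color" where
  "coloring_of A b = (if b \<in> A then Green else Red)"

text \<open>A family of candidate green sets describes what the adversary has left open.  A strategy is only
  required to be correct on the union of the family, as all other balls are known to be red.\<close>

definition forces :: "nat \<Rightarrow> nat set set \<Rightarrow> bool" where
  "forces k F \<longleftrightarrow> (\<forall>t. (\<forall>A\<in>F. \<forall>b\<in>\<Union>F. announced t (coloring_of A) b = coloring_of A b)
     \<longrightarrow> (\<exists>A\<in>F. k \<le> comparisons t (coloring_of A)))"

text \<open>The comparison of \<open>i\<close> and \<open>j\<close> reveals nothing about which member of the family is the true one.\<close>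

definition same_answer :: "nat \<Rightarrow> nat \<Rightarrow> nat set set \<Rightarrow> bool" where
  "same_answer i j F \<longleftrightarrow> (\<forall>A\<in>F. i \<in> A \<longleftrightarrow> j \<in> A) \<or> (\<forall>A\<in>F. i \<in> A \<longleftrightarrow> j \<notin> A)"

lemma coloring_of_eq_iff: "coloring_of A i = coloring_of A j \<longleftrightarrow> (i \<in> A \<longleftrightarrow> j \<in> A)"
  by (simp add: coloring_of_def)

lemma same_answer_commute: "same_answer i j F \<longleftrightarrow> same_answer j i F"
  unfolding same_answer_def by blast

lemma forces_0: "F \<noteq> {} \<Longrightarrow> forces 0 F"
  unfolding forces_def by auto

lemma forces_le: "forces k F \<Longrightarrow> l \<le> k \<Longrightarrow> forces l F"
  unfolding forces_def by (meson order_trans)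

text \<open>The adversary argument as an induction principle: against each informative comparison it has to
  name a subfamily that fixes the answer and still forces \<open>k\<close> comparisons.  Comparisons with a
  foregone answer do not change the family, so the induction over the strategy simply skips them.\<close>

lemma forces_Suc:
  assumes distinct: "A \<in> F" "A' \<in> F" "A \<noteq> A'"
    and reply: "\<And>i j. \<not> same_answer i j F \<Longrightarrow> \<exists>F'\<subseteq>F. same_answer i j F' \<and> forces k F'"
  shows "forces (Suc k) F"
  unfolding forces_def
proof (intro allI impI)
  fix t
  assume "\<forall>A\<in>F. \<forall>b\<in>\<Union>F. announced t (coloring_of A) b = coloring_of A b"
  then show "\<exists>A\<in>F. Suc k \<le> comparisons t (coloring_of A)"
  proof (induction t)
    case (Announce f)
    have "coloring_of A b = coloring_of A' b" if "b \<in> A \<union> A'" for b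
      using Announce distinct that by (metis UnE UnionI announced.simps(1))
    then have "A = A'"
      unfolding coloring_of_def by (metis UnCI color.distinct(1) set_eqI)
    with distinct show ?case by simp
  next
    case (Compare i j s d)
    (* on a family that fixes the answer, the node behaves like one of its two subtrees *)
    have go: "\<exists>u\<in>{s, d}. (\<forall>A\<in>F'. announced (Compare i j s d) (coloring_of A) = announced u (coloring_of A)
         \<and> comparisons (Compare i j s d) (coloring_of A) = Suc (comparisons u (coloring_of A)))"
      if "same_answer i j F'" for F'
      using that unfolding same_answer_def by (auto simp: coloring_of_eq_iff)
    show ?case
    proof (cases "same_answer i j F")
      case True
      then obtain u where u: "u \<in> {s, d}"
        "\<forall>A\<in>F. announced (Compare i j s d) (coloring_of A) = announced u (coloring_of A)
         \<and> comparisons (Compare i j s d) (coloring_of A) = Suc (comparisons u (coloring_of A))"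
        using go by blast
      then have "\<forall>A\<in>F. \<forall>b\<in>\<Union>F. announced u (coloring_of A) b = coloring_of A b"
        using Compare.prems by metis
      with u(1) Compare.IH obtain B where "B \<in> F" "Suc k \<le> comparisons u (coloring_of B)"
        by blast
      with u(2) show ?thesis by (metis Suc_leD Suc_le_mono)
    next
      case False
      then obtain F' where F': "F' \<subseteq> F" "same_answer i j F'" "forces k F'"
        using reply by blast
      then obtain u where u:
        "\<forall>A\<in>F'. announced (Compare i j s d) (coloring_of A) = announced u (coloring_of A)
         \<and> comparisons (Compare i j s d) (coloring_of A) = Suc (comparisons u (coloring_of A))"
        using go by blast
      have "\<forall>A\<in>F'. \<forall>b\<in>\<Union>F'. announced u (coloring_of A) b = coloring_of A b"
        using Compare.prems u F'(1) by (metis Union_mono subsetD)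
      with F'(3) obtain B where "B \<in> F'" "k \<le> comparisons u (coloring_of B)"
        unfolding forces_def by blast
      with u F'(1) show ?thesis by (metis Suc_le_mono subsetD)
    qed
  qed
qed

section \<open>Colorings constant on blocks\<close>

text \<open>The green sets compatible with this knowledge: the balls of \<open>G\<close> are green, each block of \<open>M\<close> is
  monochromatic, all balls outside are red, and at most \<open>p\<close> balls are green.\<close>

definition block_unions :: "nat \<Rightarrow> nat set \<Rightarrow> nat set set \<Rightarrow> nat set set" where
  "block_unions p G M = {G \<union> \<Union>S |S. S \<subseteq> M \<and> card (G \<union> \<Union>S) \<le> p}"

lemma base_in_block_unions: "card G \<le> p \<Longrightarrow> G \<in> block_unions p G M"
  unfolding block_unions_def by (auto intro!: exI[of _ "{}"])

lemma base_Un_block_in_block_unions: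
  "B \<in> M \<Longrightarrow> card (G \<union> B) \<le> p \<Longrightarrow> G \<union> B \<in> block_unions p G M"
  unfolding block_unions_def by (auto intro!: exI[of _ "{B}"])

lemma block_unions_mono: "M' \<subseteq> M \<Longrightarrow> block_unions p G M' \<subseteq> block_unions p G M"
  unfolding block_unions_def by blast

lemma block_unions_fix_green:
  assumes "B \<in> M" "M' \<subseteq> M"
  shows "block_unions p (G \<union> B) M' \<subseteq> block_unions p G M"
proof
  fix A assume "A \<in> block_unions p (G \<union> B) M'"
  then obtain S where "S \<subseteq> M'" "A = G \<union> B \<union> \<Union>S" "card A \<le> p"
    unfolding block_unions_def by blast
  then have "insert B S \<subseteq> M" "A = G \<union> \<Union>(insert B S)" "card A \<le> p"
    using assms by auto
  then show "A \<in> block_unions p G M"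
    unfolding block_unions_def by blast
qed

text \<open>Each of the following inclusions is a possible reply of the adversary: to give up a block by
  colouring it red (\<open>block_unions_mono\<close>) or green (\<open>block_unions_fix_green\<close>), or to declare two
  blocks equally coloured.\<close>

lemma block_unions_merge:
  assumes "B \<in> M" "B' \<in> M"
  shows "block_unions p G (insert (B \<union> B') (M - {B, B'})) \<subseteq> block_unions p G M"
proof
  fix A assume "A \<in> block_unions p G (insert (B \<union> B') (M - {B, B'}))"
  then obtain S where S: "S \<subseteq> insert (B \<union> B') (M - {B, B'})" "A = G \<union> \<Union>S" "card A \<le> p"
    unfolding block_unions_def by blast
  define S' where "S' = (if B \<union> B' \<in> S then insert B (insert B' (S - {B \<union> B'})) else S)"
  have "S' \<subseteq> M" "A = G \<union> \<Union>S'"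
    using S assms by (auto simp: S'_def split: if_splits)
  with S(3) show "A \<in> block_unions p G M"
    unfolding block_unions_def by blast
qed

lemma mem_block_unions_outside:
  "A \<in> block_unions p G M \<Longrightarrow> x \<notin> \<Union>M \<Longrightarrow> x \<in> A \<longleftrightarrow> x \<in> G"
  unfolding block_unions_def by blast

lemma mem_block_unions_block:
  assumes "A \<in> block_unions p G M" "disjoint M" "G \<inter> \<Union>M = {}" "B \<in> M" "x \<in> B" "y \<in> B"
  shows "x \<in> A \<longleftrightarrow> y \<in> A"
proof -
  obtain S where S: "S \<subseteq> M" "A = G \<union> \<Union>S"
    using assms(1) unfolding block_unions_def by blast
  have "x \<in> A \<longleftrightarrow> B \<in> S" if "x \<in> B" for x
    using S assms that by (auto dest: disjointD)
  with assms show ?thesis by blast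
qed

lemma same_answer_outside:
  "i \<notin> \<Union>M \<Longrightarrow> j \<notin> \<Union>M \<Longrightarrow> same_answer i j (block_unions p G M)"
  unfolding same_answer_def using mem_block_unions_outside by metis

lemma partition_on_remove:
  assumes "partition_on V M" "B \<in> M"
  shows "partition_on (V - B) (M - {B})"
  using assms unfolding partition_on_def disjoint_def by auto

lemma partition_on_merge:
  assumes "partition_on V M" "B \<in> M" "B' \<in> M" "B \<noteq> B'"
  shows "partition_on V (insert (B \<union> B') (M - {B, B'}))"
proof -
  have M: "\<Union>M = V" "disjoint M" "{} \<notin> M" using assms(1) unfolding partition_on_def by auto
  have "C \<inter> (B \<union> B') = {}" if "C \<in> M - {B, B'}" for C
    using that disjointD[OF M(2), of C B] disjointD[OF M(2), of C B'] assms by auto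
  then have "disjoint (insert (B \<union> B') (M - {B, B'}))"
    using M(2) unfolding disjoint_def by (auto simp: Int_commute)
  moreover have "\<Union>(insert (B \<union> B') (M - {B, B'})) = V" using M(1) assms(2,3) by blast
  moreover have "{} \<notin> insert (B \<union> B') (M - {B, B'})" using M(3) assms(2) by auto
  ultimately show ?thesis unfolding partition_on_def by blast
qed

lemma partition_on_sizes:
  assumes "partition_on V M" "finite V" "B \<in> M"
  shows "card (V - B) + card B = card V" "card (M - {B}) + 1 = card M" "B \<subseteq> V" "finite M" "finite B"
    "B \<noteq> {}"
proof -
  show M: "finite M" using finite_elements assms by blast
  show B: "B \<subseteq> V" using assms unfolding partition_on_def by blast
  then show "finite B" using assms finite_subset by blast
  show "card (V - B) + card B = card V"
    using card_mono[OF assms(2) B] card_Diff_subset[OF finite_subset[OF B assms(2)] B] by simp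
  show "card (M - {B}) + 1 = card M" using M assms(3) card_Suc_Diff1 by fastforce
  show "B \<noteq> {}" using assms unfolding partition_on_def by blast
qed

lemma partition_on_merge_card:
  assumes "partition_on V M" "finite V" "B \<in> M" "B' \<in> M" "B \<noteq> B'"
  shows "card (insert (B \<union> B') (M - {B, B'})) + 1 = card M"
proof -
  have M: "finite M" using finite_elements assms by blast
  have "B \<union> B' \<notin> M - {B, B'}"
    using assms(3) disjointD[OF partition_onD2[OF assms(1)], of B "B \<union> B'"] partition_onD3[OF assms(1)]
    by auto
  moreover have "card (M - {B, B'}) = card M - 2"
    using assms M by (subst card_Diff_subset) auto
  moreover have "card {B, B'} \<le> card M" using assms M by (intro card_mono) auto
  ultimately show ?thesis using M assms(5) by simp
qed

lemma mem_block_unions_merged: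
  assumes "partition_on V M" "A \<in> block_unions p G (insert (B \<union> B') (M - {B, B'}))" "G \<inter> V = {}"
    and "B \<in> M" "B' \<in> M" "B \<noteq> B'" "i \<in> B" "j \<in> B'"
  shows "i \<in> A \<longleftrightarrow> j \<in> A"
  using partition_on_merge[OF assms(1,4,5,6)] assms(3,7,8) unfolding partition_on_def
  by (intro mem_block_unions_block[OF assms(2), of "B \<union> B'"]) auto

text \<open>The adversary keeps blocks of at most \<open>p'\<close> balls, each of which may still be green.  A merger that
  would exceed \<open>p'\<close> balls is answered by colouring both blocks red: this loses two blocks at the price
  of one comparison, but it uses up \<open>p' + 1\<close> balls, which the subtracted quotient pays for.\<close>

lemma forces_block_unions:
  assumes "partition_on V M" "finite V" "G \<inter> V = {}"
    and "\<And>B. B \<in> M \<Longrightarrow> card B \<le> p'" "card G + p' \<le> p"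
  shows "forces (card M - card V div (p' + 1)) (block_unions p G M)"
  using assms
proof (induction "card M" arbitrary: M V rule: less_induct)
  case less
  let ?F = "block_unions p G M"
  note part = less.prems(1) and fin = less.prems(2)
  have UM: "\<Union>M = V" "disjoint M" using part unfolding partition_on_def by auto
  have GF: "G \<in> ?F" using less.prems by (intro base_in_block_unions) simp
  show ?case
  proof (cases "card M - card V div (p' + 1)")
    case 0
    show ?thesis unfolding 0 by (rule forces_0) (use GF in blast)
  next
    case (Suc k)
    then have "M \<noteq> {}" by auto
    then obtain B where B: "B \<in> M" by blast
    note sB = partition_on_sizes[OF part fin B]
    have "card (G \<union> B) \<le> p"
      using card_Un_le[of G B] less.prems(4)[OF B] less.prems(5) by linarith
    then have BF: "G \<union> B \<in> ?F"
      using B by (rule base_Un_block_in_block_unions[rotated])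
    have "B \<subseteq> V" "B \<noteq> {}" using sB by auto
    then have ne: "G \<noteq> G \<union> B" using less.prems(3) by blast
    have reply: "\<exists>F'\<subseteq>?F. same_answer i j F' \<and> forces k F'"
      if B: "B \<in> M" "i \<in> B" "j \<notin> B" for i j B
    proof -
      note sB = partition_on_sizes[OF part fin B(1)]
      have drop: "partition_on (V - B) (M - {B})" using partition_on_remove[OF part B(1)] .
      have iout: "i \<notin> \<Union>(M - {B})" using drop B unfolding partition_on_def by blast
      show ?thesis
      proof (cases "j \<in> V")
        case False
        have "forces (card (M - {B}) - card (V - B) div (p' + 1)) (block_unions p G (M - {B}))"
          using less.prems sB B by (intro less.hyps drop) auto
        moreover have "k \<le> card (M - {B}) - card (V - B) div (p' + 1)"
        proof -
          have "card (V - B) div (p' + 1) \<le> card V div (p' + 1)"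
            using sB by (intro div_le_mono) linarith
          then show ?thesis using Suc sB by linarith
        qed
        moreover have "j \<notin> \<Union>(M - {B})" using False UM by blast
        ultimately show ?thesis using forces_le same_answer_outside[OF iout] block_unions_mono
          by (metis Diff_subset)
      next
        case True
        then obtain B' where B': "B' \<in> M" "j \<in> B'" using UM by blast
        have BB': "B \<noteq> B'" using B' B by blast
        have disj: "B \<inter> B' = {}" using UM B B' BB' by (metis disjointD)
        note sB' = partition_on_sizes[OF part fin B'(1)]
        have cBB': "card (B \<union> B') = card B + card B'" using disj sB sB' by (simp add: card_Un_disjoint)
        show ?thesis
        proof (cases "card (B \<union> B') \<le> p'")
          case True
          let ?M = "insert (B \<union> B') (M - {B, B'})"
          have pm: "partition_on V ?M" using partition_on_merge[OF part B(1) B'(1) BB'] .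
          have cm: "card ?M + 1 = card M" using partition_on_merge_card[OF part fin B(1) B'(1) BB'] .
          have "forces (card ?M - card V div (p' + 1)) (block_unions p G ?M)"
            using less.prems cm True by (intro less.hyps pm) auto
          moreover have "k \<le> card ?M - card V div (p' + 1)" using cm Suc by linarith
          moreover have "same_answer i j (block_unions p G ?M)"
          proof -
            have "i \<in> A \<longleftrightarrow> j \<in> A" if "A \<in> block_unions p G ?M" for A
              using mem_block_unions_merged[OF part that less.prems(3)] B B' BB' by blast
            then show ?thesis unfolding same_answer_def by blast
          qed
          ultimately show ?thesis using forces_le block_unions_merge[OF B(1) B'(1)] by meson
        next
          case False
          have B'2: "B' \<in> M - {B}" using B' BB' by blast
          have drop2: "partition_on (V - B - B') (M - {B} - {B'})"
            using partition_on_remove[OF drop B'2] .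
          note s2 = partition_on_sizes[OF drop _ B'2]
          have "forces (card (M - {B} - {B'}) - card (V - B - B') div (p' + 1))
              (block_unions p G (M - {B} - {B'}))"
            using less.prems sB s2 by (intro less.hyps drop2) auto
          moreover have "k \<le> card (M - {B} - {B'}) - card (V - B - B') div (p' + 1)"
          proof -
            have "card (V - B - B') + (p' + 1) \<le> card V" using False cBB' sB s2 fin by simp
            then have "(card (V - B - B') + (p' + 1)) div (p' + 1) \<le> card V div (p' + 1)"
              by (rule div_le_mono)
            then have "card (V - B - B') div (p' + 1) + 1 \<le> card V div (p' + 1)"
              using div_add_self2[of "p' + 1" "card (V - B - B')"] by linarith
            then show ?thesis using Suc sB s2 fin by simp
          qed
          moreover have "same_answer i j (block_unions p G (M - {B} - {B'}))"
            using B B' drop2 unfolding partition_on_def by (intro same_answer_outside) auto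
          moreover have "block_unions p G (M - {B} - {B'}) \<subseteq> ?F" by (intro block_unions_mono) auto
          ultimately show ?thesis using forces_le by meson
        qed
      qed
    qed
    have "forces (Suc k) ?F"
    proof (rule forces_Suc[OF GF BF ne])
      fix i j assume split: "\<not> same_answer i j ?F"
      then have "i \<in> V \<or> j \<in> V" using same_answer_outside UM by blast
      moreover have "\<not> (i \<in> B \<and> j \<in> B)" if "B \<in> M" for B
        using split that mem_block_unions_block[OF _ UM(2)] less.prems(3) UM(1)
        unfolding same_answer_def by metis
      ultimately consider B where "B \<in> M" "i \<in> B" "j \<notin> B" | B where "B \<in> M" "j \<in> B" "i \<notin> B"
        using UM by blast
      then show "\<exists>F'\<subseteq>?F. same_answer i j F' \<and> forces k F'"
        using reply same_answer_commute by cases metis+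
    qed
    with Suc show ?thesis by simp
  qed
qed

text \<open>The classes \<open>X\<close> and \<open>Y\<close> have different colours, but it is open which of them is green.  A block that
  is compared with one of the two classes is added to \<open>Y\<close>; as \<open>card Y + card V \<le> p\<close> remains true,
  the orientation stays open.  So beyond one comparison for every block one more is needed to decide
  the orientation; when it happens, the adversary lets \<open>Y\<close> be green, which leaves all blocks of \<open>M\<close>
  undecided.\<close>

lemma forces_opposite_pair:
  assumes "partition_on V M" "finite V" "X \<inter> Y = {}" "X \<inter> V = {}" "Y \<inter> V = {}"
    and "X \<noteq> {}" "card X \<le> p" "card Y + card V \<le> p"
  shows "forces (Suc (card M)) (block_unions p X M \<union> block_unions p Y M)"
  using assms
proof (induction "card M" arbitrary: M V Y rule: less_induct)
  case less
  let ?F = "block_unions p X M \<union> block_unions p Y M"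
  note part = less.prems(1) and fin = less.prems(2)
  have UM: "\<Union>M = V" "disjoint M" using part unfolding partition_on_def by auto
  have disjUM: "X \<inter> \<Union>M = {}" "Y \<inter> \<Union>M = {}" using less.prems UM by auto
  have XF: "X \<in> ?F" and YF: "Y \<in> ?F" using less.prems base_in_block_unions by auto
  have ne: "X \<noteq> Y" using less.prems by blast
  have reply: "\<exists>F'\<subseteq>?F. same_answer i j F' \<and> forces (card M) F'"
    if B: "B \<in> M" "i \<in> B" "j \<notin> B" for i j B
  proof -
    note sB = partition_on_sizes[OF part fin B(1)]
    have drop: "partition_on (V - B) (M - {B})" using partition_on_remove[OF part B(1)] .
    have out: "i \<notin> \<Union>(M - {B})" using drop B unfolding partition_on_def by blast
    have iXY: "i \<notin> X" "i \<notin> Y" using B UM disjUM by auto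
    have cM: "Suc (card (M - {B})) = card M" using sB by simp
    have disjV: "X \<inter> B = {}" "X \<inter> (V - B) = {}" "Y \<inter> (V - B) = {}" "(Y \<union> B) \<inter> (V - B) = {}"
      using less.prems(4,5) sB(3) by auto
    consider (block) B' where "B' \<in> M" "j \<in> B'" | (comp) "j \<in> X \<union> Y" | (fixed) "j \<notin> X \<union> Y \<union> V"
      using UM by blast
    then show ?thesis
    proof cases
      case fixed
      let ?F' = "block_unions p X (M - {B}) \<union> block_unions p Y (M - {B})"
      have "forces (Suc (card (M - {B}))) ?F'"
        using less.prems sB disjV by (intro less.hyps[OF _ drop]) simp_all
      moreover have "i \<notin> A \<and> j \<notin> A" if "A \<in> ?F'" for A
      proof -
        have "j \<notin> \<Union>(M - {B})" using fixed UM by blast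
        then show ?thesis
          using that mem_block_unions_outside[of A p X "M - {B}"] mem_block_unions_outside[of A p Y "M - {B}"]
            out fixed iXY by blast
      qed
      then have "same_answer i j ?F'" unfolding same_answer_def by blast
      moreover have "?F' \<subseteq> ?F" by (intro Un_mono block_unions_mono) auto
      ultimately show ?thesis using cM by metis
    next
      case comp
      let ?F' = "block_unions p X (M - {B}) \<union> block_unions p (Y \<union> B) (M - {B})"
      have "card (Y \<union> B) \<le> card Y + card B" by (rule card_Un_le)
      then have "forces (Suc (card (M - {B}))) ?F'"
        using less.prems sB disjV by (intro less.hyps[OF _ drop]) (simp_all add: Int_Un_distrib)
      moreover have "same_answer i j ?F'"
      proof -
        have jout: "j \<notin> \<Union>(M - {B})" using comp UM less.prems by blast
        have mem: "i \<in> A \<longleftrightarrow> i \<in> G" "j \<in> A \<longleftrightarrow> j \<in> G" if "A \<in> block_unions p G (M - {B})" for A G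
          using mem_block_unions_outside[OF that] out jout by auto
        show ?thesis
        proof (cases "j \<in> X")
          case True
          then have "i \<in> A \<longleftrightarrow> j \<notin> A" if "A \<in> ?F'" for A
            using that mem[of A X] mem[of A "Y \<union> B"] iXY B less.prems(3) by blast
          then show ?thesis unfolding same_answer_def by blast
        next
          case False
          then have "i \<in> A \<longleftrightarrow> j \<in> A" if "A \<in> ?F'" for A
            using that mem[of A X] mem[of A "Y \<union> B"] iXY B comp by blast
          then show ?thesis unfolding same_answer_def by blast
        qed
      qed
      moreover have "?F' \<subseteq> ?F"
        using B by (intro Un_mono block_unions_mono block_unions_fix_green) auto
      ultimately show ?thesis using cM by metis
    next
      case block
      have BB': "B \<noteq> B'" using block B by blast
      let ?M = "insert (B \<union> B') (M - {B, B'})"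
      let ?F' = "block_unions p X ?M \<union> block_unions p Y ?M"
      have pm: "partition_on V ?M" using partition_on_merge[OF part B(1) block(1) BB'] .
      have cm: "card ?M + 1 = card M" using partition_on_merge_card[OF part fin B(1) block(1) BB'] .
      have "forces (Suc (card ?M)) ?F'"
        using less.prems cm by (intro less.hyps[OF _ pm]) simp_all
      moreover have "same_answer i j ?F'"
      proof -
        have "i \<in> A \<longleftrightarrow> j \<in> A" if "A \<in> block_unions p G ?M" "G \<inter> V = {}" for A G
          using mem_block_unions_merged[OF part that B(1) block(1) BB' B(2) block(2)] .
        then show ?thesis using less.prems(4,5) unfolding same_answer_def by blast
      qed
      moreover have "?F' \<subseteq> ?F" by (intro Un_mono block_unions_merge B block)
      ultimately show ?thesis using cm by (metis Suc_eq_plus1)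
    qed
  qed
  show ?case
  proof (rule forces_Suc[OF XF YF ne])
    fix i j assume split: "\<not> same_answer i j ?F"
    have "\<not> (i \<in> B \<and> j \<in> B)" if "B \<in> M" for B
      using split that mem_block_unions_block[OF _ UM(2)] disjUM
      unfolding same_answer_def by (metis Un_iff)
    then consider B where "B \<in> M" "i \<in> B" "j \<notin> B" | B where "B \<in> M" "j \<in> B" "i \<notin> B"
      | "i \<notin> V" "j \<notin> V"
      using UM by blast
    then show "\<exists>F'\<subseteq>?F. same_answer i j F' \<and> forces (card M) F'"
    proof cases
      case 1 then show ?thesis by (rule reply)
    next
      case 2 then show ?thesis using reply same_answer_commute by metis
    next
      case 3
      (* The orientation becomes known.  Choosing Y as the green class leaves the largest number of
         green balls for the blocks. *)
      have "forces (card M - card V div ((p - card Y) + 1)) (block_unions p Y M)"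
      proof (rule forces_block_unions[OF part fin])
        fix B assume "B \<in> M"
        then have "card B \<le> card V"
          using card_mono[OF fin] partition_on_sizes(3)[OF part fin] by simp
        then show "card B \<le> p - card Y" using less.prems(8) by linarith
      qed (use less.prems(5,8) in auto)
      moreover have "card V div ((p - card Y) + 1) = 0" using less.prems by simp
      ultimately have "forces (card M) (block_unions p Y M)" by simp
      then show ?thesis using same_answer_outside 3 UM by blast
    qed
  qed
qed

text \<open>Compared with \<open>forces_block_unions\<close> this gains one comparison.  The parameter \<open>q\<close> counts the
  mergers beyond \<open>p\<close> balls that are still possible, but it is not tied to the exact quotient: when a
  block is coloured red, \<open>V\<close> shrinks while \<open>q\<close> may stay.  Once \<open>V\<close> is too small for \<open>q\<close> such mergers,
  the previous bound suffices.  For \<open>q > 1\<close> such a merger is answered as before; the last one is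
  answered ``different''.\<close>

lemma forces_block_unions_small_remainder:
  assumes "partition_on V M" "finite V" "\<And>B. B \<in> M \<Longrightarrow> card B \<le> p"
    and "card V \<le> q * (p + 1) + r" "2 * r \<le> p" "1 \<le> q"
  shows "forces (card M + 1 - q) (block_unions p {} M)"
  using assms
proof (induction "card M" arbitrary: M V q rule: less_induct)
  case less
  let ?F = "block_unions p {} M"
  note part = less.prems(1) and fin = less.prems(2)
  have UM: "\<Union>M = V" "disjoint M" using part unfolding partition_on_def by auto
  have GF: "{} \<in> ?F" by (intro base_in_block_unions) simp
  show ?case
  proof (cases "card V < q * (p + 1)")
    case True
    have "forces (card M - card V div (p + 1)) ?F"
      using less.prems by (intro forces_block_unions) auto
    moreover have "card V div (p + 1) < q"
      using True by (simp add: div_less_iff_less_mult)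
    then have "card M + 1 - q \<le> card M - card V div (p + 1)" by linarith
    ultimately show ?thesis by (rule forces_le)
  next
    case large: False
    show ?thesis
    proof (cases "card M + 1 - q")
      case 0
      show ?thesis unfolding 0 by (rule forces_0) (use GF in blast)
    next
      case (Suc k)
      have "V \<noteq> {}" using large less.prems by auto
      then obtain B where B: "B \<in> M" using UM by blast
      have BF: "{} \<union> B \<in> ?F"
        using B less.prems(3)[OF B] by (intro base_Un_block_in_block_unions) auto
      have ne: "{} \<noteq> {} \<union> B" using partition_on_sizes[OF part fin B] by auto
      have reply: "\<exists>F'\<subseteq>?F. same_answer i j F' \<and> forces k F'"
        if B: "B \<in> M" "i \<in> B" "j \<notin> B" for i j B
      proof -
        note sB = partition_on_sizes[OF part fin B(1)]
        have drop: "partition_on (V - B) (M - {B})" using partition_on_remove[OF part B(1)] .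
        have iout: "i \<notin> \<Union>(M - {B})" using drop B unfolding partition_on_def by blast
        show ?thesis
        proof (cases "j \<in> V")
          case False
          have "forces (card (M - {B}) + 1 - q) (block_unions p {} (M - {B}))"
            using less.prems sB by (intro less.hyps[OF _ drop]) auto
          moreover have "k \<le> card (M - {B}) + 1 - q" using Suc sB by linarith
          moreover have "j \<notin> \<Union>(M - {B})" using False UM by blast
          ultimately show ?thesis using forces_le same_answer_outside[OF iout] block_unions_mono
            by (metis Diff_subset)
        next
          case True
          then obtain B' where B': "B' \<in> M" "j \<in> B'" using UM by blast
          have BB': "B \<noteq> B'" using B' B by blast
          have disj: "B \<inter> B' = {}" using UM B B' BB' by (metis disjointD)
          note sB' = partition_on_sizes[OF part fin B'(1)]
          have cBB': "card (B \<union> B') = card B + card B'" using disj sB sB' by (simp add: card_Un_disjoint)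
          show ?thesis
          proof (cases "card (B \<union> B') \<le> p")
            case True
            let ?M = "insert (B \<union> B') (M - {B, B'})"
            have pm: "partition_on V ?M" using partition_on_merge[OF part B(1) B'(1) BB'] .
            have cm: "card ?M + 1 = card M" using partition_on_merge_card[OF part fin B(1) B'(1) BB'] .
            have "forces (card ?M + 1 - q) (block_unions p {} ?M)"
              using less.prems cm True by (intro less.hyps[OF _ pm]) auto
            moreover have "k \<le> card ?M + 1 - q" using cm Suc by linarith
            moreover have "same_answer i j (block_unions p {} ?M)"
            proof -
              have "i \<in> A \<longleftrightarrow> j \<in> A" if "A \<in> block_unions p {} ?M" for A
                using mem_block_unions_merged[OF part that] B B' BB' by blast
              then show ?thesis unfolding same_answer_def by blast
            qed
            ultimately show ?thesis using forces_le block_unions_merge[OF B(1) B'(1)] by meson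
          next
            case False
            have B'2: "B' \<in> M - {B}" using B' BB' by blast
            have drop2: "partition_on (V - B - B') (M - {B} - {B'})"
              using partition_on_remove[OF drop B'2] .
            note s2 = partition_on_sizes[OF drop _ B'2]
            have jout: "j \<notin> \<Union>(M - {B} - {B'})" and iout2: "i \<notin> \<Union>(M - {B} - {B'})"
              using drop2 B B' unfolding partition_on_def by auto
            have cV: "card (V - B - B') + card B + card B' = card V" using sB s2 fin by simp
            show ?thesis
            proof (cases "q = 1")
              case True
              let ?F' = "block_unions p B (M - {B} - {B'}) \<union> block_unions p B' (M - {B} - {B'})"
              have opp: "forces (Suc (card (M - {B} - {B'}))) ?F'"
                if "card X \<le> p" "card Y + card (V - B - B') \<le> p" "{X, Y} = {B, B'}" for X Y
              proof -
                have "?F' = block_unions p X (M - {B} - {B'}) \<union> block_unions p Y (M - {B} - {B'})"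
                  using that(3) by (auto simp: doubleton_eq_iff)
                moreover have "forces (Suc (card (M - {B} - {B'})))
                    (block_unions p X (M - {B} - {B'}) \<union> block_unions p Y (M - {B} - {B'}))"
                  using that sB sB' disj fin
                  by (intro forces_opposite_pair[OF drop2]) (auto simp: doubleton_eq_iff)
                ultimately show ?thesis by simp
              qed
              (* The larger block has more than p / 2 balls, hence more than r; so the smaller block
                 and the rest of V, at most p + 1 + r balls minus the larger block, fit into p. *)
              have "card V \<le> p + 1 + r" using less.prems(4) True by simp
              then have "card B' + card (V - B - B') \<le> p \<or> card B + card (V - B - B') \<le> p"
                using cV cBB' False less.prems(5) by linarith
              then have "forces (Suc (card (M - {B} - {B'}))) ?F'"
                using opp[of B B'] opp[of B' B] less.prems(3) B B' by (auto simp: insert_commute)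
              moreover have "k \<le> Suc (card (M - {B} - {B'}))" using Suc True sB s2 fin by simp
              moreover have "i \<in> A \<longleftrightarrow> j \<notin> A" if "A \<in> ?F'" for A
                using that mem_block_unions_outside iout2 jout B B' disj by blast
              then have "same_answer i j ?F'" unfolding same_answer_def by blast
              moreover have "?F' \<subseteq> ?F"
                using block_unions_fix_green[of B M "M - {B} - {B'}" p "{}"]
                  block_unions_fix_green[of B' M "M - {B} - {B'}" p "{}"] B B' by auto
              ultimately show ?thesis using forces_le by blast
            next
              case q: False
              have qe: "q * (p + 1) = (q - 1) * (p + 1) + (p + 1)"
                using less.prems(6) by (cases q) auto
              have "forces (card (M - {B} - {B'}) + 1 - (q - 1)) (block_unions p {} (M - {B} - {B'}))"
              proof (rule less.hyps[OF _ drop2])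
                show "card (V - B - B') \<le> (q - 1) * (p + 1) + r"
                  using less.prems(4) False cV cBB' unfolding qe by linarith
              qed (use less.prems sB s2 fin q in auto)
              moreover have "k \<le> card (M - {B} - {B'}) + 1 - (q - 1)"
                using Suc sB s2 fin less.prems(6) q by simp
              moreover have "block_unions p {} (M - {B} - {B'}) \<subseteq> ?F" by (intro block_unions_mono) auto
              ultimately show ?thesis using forces_le same_answer_outside[OF iout2 jout] by meson
            qed
          qed
        qed
      qed
      have "forces (Suc k) ?F"
      proof (rule forces_Suc[OF GF BF ne])
        fix i j assume split: "\<not> same_answer i j ?F"
        then have "i \<in> V \<or> j \<in> V" using same_answer_outside UM by blast
        moreover have "\<not> (i \<in> B \<and> j \<in> B)" if "B \<in> M" for B
          using split that mem_block_unions_block[OF _ UM(2)]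
          unfolding same_answer_def by (metis Int_empty_left)
        ultimately consider B where "B \<in> M" "i \<in> B" "j \<notin> B" | B where "B \<in> M" "j \<in> B" "i \<notin> B"
          using UM by blast
        then show "\<exists>F'\<subseteq>?F. same_answer i j F' \<and> forces k F'"
          using reply same_answer_commute by cases metis+
      qed
      with Suc show ?thesis by simp
    qed
  qed
qed
section \<open>Lower bounds\<close>

lemma majored_coloring_of:
  assumes "A \<subseteq> {1..N}" "card A \<le> p" "2 * p < N"
  shows "majored N p (coloring_of A)"
proof -
  have "green_balls N (coloring_of A) = A" "red_balls N (coloring_of A) = {1..N} - A"
    using assms by (auto simp: green_balls_def red_balls_def coloring_of_def split: if_splits)
  moreover have "card ({1..N} - A) = N - card A"
    using assms(1) by (simp add: card_Diff_subset finite_subset)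
  ultimately show ?thesis
    using assms unfolding majored_def red_green_coloring_def by simp
qed

text \<open>The condition \<open>2 * p < N\<close> makes every set of at most \<open>p\<close> balls the green set of a majored
  coloring, so the whole family consists of admissible inputs.\<close>

lemma forces_imp_le:
  assumes "forces k (block_unions p {} M)" "\<Union>M \<subseteq> {1..N}" "2 * p < N" "solves N p l t"
  shows "k \<le> l"
proof -
  let ?F = "block_unions p {} M"
  have sub: "A \<subseteq> {1..N}" "card A \<le> p" if "A \<in> ?F" for A
    using that assms(2) unfolding block_unions_def by auto
  have "comparisons t (coloring_of A) \<le> l \<and> (\<forall>b\<in>{1..N}. announced t (coloring_of A) b = coloring_of A b)"
    if "A \<in> ?F" for A
    using assms(3,4) majored_coloring_of[OF sub[OF that]] unfolding solves_def by blast
  moreover from this have "\<exists>A\<in>?F. k \<le> comparisons t (coloring_of A)"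
    using assms(1) sub(1) unfolding forces_def by (meson UnionE subsetD)
  ultimately show ?thesis by (meson order_trans)
qed

lemma partition_on_balls: "partition_on {1..N} ((\<lambda>b. {b}) ` {1..N})"
  by (rule partition_on_singletons)

lemma card_singletons: "card ((\<lambda>b. {b}) ` {1..N::nat}) = N"
  by (simp add: card_image inj_on_def)

lemma solves_lower:
  assumes "2 * p < N" "solves N p l t"
  shows "N - N div (p + 1) \<le> l"
proof (cases "p = 0")
  (* for p = 0 the singletons are too large as blocks, but then the bound is 0 *)
  case False
  have "forces (card ((\<lambda>b. {b}) ` {1..N}) - card {1..N} div (p + 1)) (block_unions p {} ((\<lambda>b. {b}) ` {1..N}))"
    using False by (intro forces_block_unions[OF partition_on_balls]) auto
  then show ?thesis
    using forces_imp_le[OF _ _ assms] unfolding card_singletons by force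
qed simp

lemma solves_lower_small_remainder:
  assumes "2 * p < N" "solves N p l t" "2 * (N mod (p + 1)) \<le> p" "0 < p"
  shows "N + 1 - N div (p + 1) \<le> l"
proof -
  have "1 \<le> N div (p + 1)" using assms(1) by (simp add: Suc_le_eq div_greater_zero_iff)
  then have "forces (card ((\<lambda>b. {b}) ` {1..N}) + 1 - N div (p + 1)) (block_unions p {} ((\<lambda>b. {b}) ` {1..N}))"
    using assms(3,4) by (intro forces_block_unions_small_remainder[OF partition_on_balls, where r = "N mod (p + 1)"]) (auto simp del: mult_Suc_right)
  then show ?thesis
    using forces_imp_le[OF _ _ assms(1,2)] unfolding card_singletons by force
qed

section \<open>The strategy\<close>

text \<open>Solvability relative to an arbitrary set \<open>C\<close> of colorings still possible, so that a strategy can be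
  built from the strategies for the two answers.\<close>

definition solvable :: "nat \<Rightarrow> nat \<Rightarrow> (nat \<Rightarrow> color) set \<Rightarrow> bool" where
  "solvable N k C \<longleftrightarrow> (\<exists>t. valid_strategy N t \<and>
     (\<forall>c\<in>C. comparisons t c \<le> k \<and> (\<forall>b\<in>{1..N}. announced t c b = c b)))"

lemma solvable_agree:
  assumes "\<And>c c' b. c \<in> C \<Longrightarrow> c' \<in> C \<Longrightarrow> b \<in> {1..N} \<Longrightarrow> c b = c' b"
  shows "solvable N k C"
proof (cases "C = {}")
  case False
  then obtain c where "c \<in> C" by blast
  then have "valid_strategy N (Announce c) \<and> (\<forall>c'\<in>C. comparisons (Announce c) c' \<le> k \<and>
      (\<forall>b\<in>{1..N}. announced (Announce c) c' b = c' b))"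
    using assms by auto
  then show ?thesis unfolding solvable_def by blast
qed (auto simp: solvable_def intro!: exI[of _ "Announce undefined"])

lemma solvable_compare:
  assumes "i \<in> {1..N}" "j \<in> {1..N}" "i \<noteq> j"
    and "solvable N k {c \<in> C. c i = c j}" "solvable N k {c \<in> C. c i \<noteq> c j}"
  shows "solvable N (Suc k) C"
proof -
  obtain s d where s: "valid_strategy N s"
      "\<And>c. c \<in> C \<Longrightarrow> c i = c j \<Longrightarrow> comparisons s c \<le> k \<and> (\<forall>b\<in>{1..N}. announced s c b = c b)"
    and d: "valid_strategy N d"
      "\<And>c. c \<in> C \<Longrightarrow> c i \<noteq> c j \<Longrightarrow> comparisons d c \<le> k \<and> (\<forall>b\<in>{1..N}. announced d c b = c b)"
    using assms(4,5) unfolding solvable_def by blast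
  have "valid_strategy N (Compare i j s d)" using assms s d by simp
  moreover have "\<forall>c\<in>C. comparisons (Compare i j s d) c \<le> Suc k \<and>
      (\<forall>b\<in>{1..N}. announced (Compare i j s d) c b = c b)"
    using s d by auto
  ultimately show ?thesis unfolding solvable_def by blast
qed

lemma card_color_classes:
  fixes c :: "nat \<Rightarrow> color"
  assumes "finite K"
  shows "card {b \<in> K. c b = v} + card {b \<in> K. c b \<noteq> v} = card K"
proof -
  have "{b \<in> K. c b = v} \<union> {b \<in> K. c b \<noteq> v} = K" "{b \<in> K. c b = v} \<inter> {b \<in> K. c b \<noteq> v} = {}"
    by blast+
  then show ?thesis using card_Un_disjoint[of "{b \<in> K. c b = v}" "{b \<in> K. c b \<noteq> v}"] assms by fastforce
qed

lemma color_neq_iff: "a \<noteq> Red \<longleftrightarrow> a = Green" "a \<noteq> Green \<longleftrightarrow> a = Red"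
  by (cases a; simp)+

text \<open>\<open>K\<close> is the component under construction, \<open>S\<close> the set of fresh balls, and all other balls are
  already known.  Up to \<open>q - 1\<close> components are to be left, of which \<open>q - 2\<close> come after the current
  one.  This explains the budget: every fresh ball costs one comparison, except for the \<open>q - 2\<close> balls
  that start the later components.  The inequality between \<open>q * (p + 1)\<close> and the number of balls
  guarantees that the fresh balls are not exhausted too early.

  As long as \<open>q \<ge> 3\<close>, a class of \<open>K\<close> that reaches \<open>p + 1\<close> balls closes the component; a class never
  gets larger, so no ball is wasted.  For \<open>q = 2\<close> the component absorbs all of \<open>S\<close>, and its at least
  \<open>2 * p + 1\<close> balls admit only one orientation.\<close>

lemma solvable_growing_component:
  assumes "K \<union> S \<subseteq> {1..N}" "K \<inter> S = {}" "K \<noteq> {}"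
    and "\<And>c c' b. c \<in> C \<Longrightarrow> c' \<in> C \<Longrightarrow> b \<in> {1..N} - K - S \<Longrightarrow> c b = c' b"
    and "\<And>c c' a b. c \<in> C \<Longrightarrow> c' \<in> C \<Longrightarrow> a \<in> K \<Longrightarrow> b \<in> K \<Longrightarrow> (c a = c b) = (c' a = c' b)"
    and "\<And>c. c \<in> C \<Longrightarrow> card {b \<in> K \<union> S. c b = Green} \<le> p"
    and "\<And>c v. c \<in> C \<Longrightarrow> 3 \<le> q \<Longrightarrow> card {b \<in> K. c b = v} \<le> p + 1"
    and "q * (p + 1) \<le> card K + card S + 1" "2 \<le> q" "card S + 2 \<le> k + q"
  shows "solvable N k C"
  using assms
proof (induction "card S" arbitrary: K S C p q k rule: less_induct)
  case less
  have fin: "finite K" "finite S" using less.prems(1) finite_subset by auto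
  have cardKS: "card (K \<union> S) = card K + card S" using fin less.prems(2) by (simp add: card_Un_disjoint)
  show ?case
  proof (cases "C = {}")
    case True
    then show ?thesis using solvable_agree by blast
  next
    case False
    then obtain c0 where c0: "c0 \<in> C" by blast
    show ?thesis
    proof (cases "3 \<le> q \<and> (\<exists>v. card {b \<in> K. c0 b = v} = p + 1)")
      case True
      then obtain v where q: "3 \<le> q" and v: "card {b \<in> K. c0 b = v} = p + 1" by blast
      let ?X = "{b \<in> K. c0 b = v}" and ?Y = "{b \<in> K. c0 b \<noteq> v}"
      obtain x where x: "x \<in> K" "c0 x = v" using v by (metis (mono_tags, lifting) Collect_empty_eq card.empty add_is_0 one_neq_zero)
      have cXY: "p + 1 + card ?Y = card K" using card_color_classes[OF fin(1), of c0 v] v by simp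
      (* the class of p + 1 balls is too large to be green *)
      have known: "c b = (if c0 b = v then Red else Green)" if c: "c \<in> C" and b: "b \<in> K" for c b
      proof -
        have iff: "c a = c x \<longleftrightarrow> c0 a = v" if "a \<in> K" for a
          using less.prems(5)[OF c c0 that x(1)] x(2) by simp
        have "c x = Red"
        proof (rule ccontr)
          assume "c x \<noteq> Red"
          then have "?X \<subseteq> {b \<in> K \<union> S. c b = Green}" using iff color_neq_iff by auto
          then have "card ?X \<le> card {b \<in> K \<union> S. c b = Green}" using fin by (intro card_mono) auto
          then show False using v less.prems(6)[OF c] by simp
        qed
        then show ?thesis using iff[OF b] color_neq_iff by auto
      qed
      have greens: "card {b \<in> S. c b = Green} + card ?Y \<le> p" if c: "c \<in> C" for c
      proof -
        have "{b \<in> S. c b = Green} \<union> ?Y \<subseteq> {b \<in> K \<union> S. c b = Green}" using known[OF c] by auto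
        then have "card ({b \<in> S. c b = Green} \<union> ?Y) \<le> card {b \<in> K \<union> S. c b = Green}"
          using fin by (intro card_mono) auto
        moreover have "{b \<in> S. c b = Green} \<inter> ?Y = {}" using less.prems(2) by blast
        ultimately show ?thesis using fin less.prems(6)[OF c] by (simp add: card_Un_disjoint)
      qed
      have yp: "card ?Y \<le> p" using greens[OF c0] by linarith
      define p' where "p' = p - card ?Y"
      obtain q' where q': "q = Suc q'" using q by (cases q) auto
      (* The component has used card Y balls more than p + 1, while lowering p to p' saves
         card Y balls in each of the q' >= 2 summands. *)
      have "p + 1 = p' + 1 + card ?Y" using yp unfolding p'_def by simp
      then have "q' * (p + 1) = q' * (p' + 1) + card ?Y * q'" by (simp only: distrib_left mult.commute)
      moreover have "card ?Y * 2 \<le> card ?Y * q'" using q q' by (intro mult_le_mono) auto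
      ultimately have size: "q' * (p' + 1) \<le> card S + 1"
        using less.prems(8) cXY unfolding q' mult_Suc by linarith
      have "1 * (p' + 1) < q' * (p' + 1)" using q q' by (intro mult_strict_right_mono) auto
      from less_le_trans[OF this size] have "0 < card S" by simp
      then have "S \<noteq> {}" by auto
      then obtain s where s: "s \<in> S" by blast
      have cS: "card S = Suc (card (S - {s}))" using card_Suc_Diff1[OF fin(2) s] by simp
      show ?thesis
      proof (rule less.hyps[of "S - {s}" "{s}" C p' q'])
        fix c c' b assume "c \<in> C" "c' \<in> C" "b \<in> {1..N} - {s} - (S - {s})"
        then show "c b = c' b"
          using less.prems(4)[of c c' b] known[of c b] known[of c' b] by (cases "b \<in> K") auto
      next
        fix c assume "c \<in> C"
        moreover have "{s} \<union> (S - {s}) = S" using s by blast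
        ultimately show "card {b \<in> {s} \<union> (S - {s}). c b = Green} \<le> p'"
          using greens unfolding p'_def by fastforce
      next
        fix c :: "nat \<Rightarrow> color" and v
        have "card {b \<in> {s}. c b = v} \<le> card {s}" by (intro card_mono) auto
        then show "card {b \<in> {s}. c b = v} \<le> p' + 1" by simp
      qed (use s cS size q q' less.prems(1,10) in auto)
    next
      case notfull: False
      have class_le: "card {b \<in> K. c b = v} \<le> p" if "c \<in> C" "3 \<le> q" for c v
      proof -
        have "card {b \<in> K. c b = v} \<noteq> p + 1"
        proof
          assume A: "card {b \<in> K. c b = v} = p + 1"
          then obtain x where x: "x \<in> K" "c x = v"
            by (metis (mono_tags, lifting) Collect_empty_eq card.empty add_is_0 one_neq_zero)
          have "{b \<in> K. c b = v} = {b \<in> K. c0 b = c0 x}"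
            using less.prems(5)[OF that(1) c0 _ x(1)] x(2) by auto
          with A have "card {b \<in> K. c0 b = c0 x} = p + 1" by simp
          then show False using notfull that(2) by blast
        qed
        then show ?thesis using less.prems(7)[OF that, of v] by linarith
      qed
      have cardK: "card K \<le> 2 * p" if "3 \<le> q"
        using class_le[OF c0 that, of Red] class_le[OF c0 that, of Green] card_color_classes[OF fin(1), of c0 Red]
        unfolding color_neq_iff by linarith
      have q3: "(q - 2) * (p + 1) + 2 * (p + 1) = q * (p + 1)"
        using less.prems(9) by (metis distrib_right le_add_diff_inverse2)
      show ?thesis
      proof (cases "S = {}")
        case True
        have "\<not> 3 \<le> q"
        proof
          assume q: "3 \<le> q"
          then have "3 * (p + 1) \<le> q * (p + 1)" by (rule mult_le_mono1)
          then show False using cardK[OF q] less.prems(8) True by simp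
        qed
        then have "q = 2" using less.prems(9) by simp
        then have cK: "2 * p + 1 \<le> card K" using less.prems(8) True by simp
        show ?thesis
        proof (rule solvable_agree, rule ccontr)
          fix c c' b assume c: "c \<in> C" "c' \<in> C" and b: "b \<in> {1..N}" "c b \<noteq> c' b"
          then have bK: "b \<in> K" using less.prems(4)[OF c] True by blast
          have "c a \<noteq> c' a" if "a \<in> K" for a
            using less.prems(5)[OF c that bK] b(2) color_neq_iff by metis
          (* two opposite orientations would contain card K > 2 * p green balls in total *)
          then have "c' a = Green \<longleftrightarrow> c a \<noteq> Green" if "a \<in> K" for a
            using that by (metis color.exhaust)
          then have "{b \<in> K. c' b = Green} = {b \<in> K. c b \<noteq> Green}" by blast
          then have "card {b \<in> K. c b = Green} + card {b \<in> K. c' b = Green} = card K"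
            using card_color_classes[OF fin(1), of c Green] by simp
          then show False using less.prems(6)[OF c(1)] less.prems(6)[OF c(2)] cK True by simp
        qed
      next
        case False
        then obtain s where s: "s \<in> S" by blast
        obtain x where x: "x \<in> K" using less.prems(3) by blast
        have cS: "card S = Suc (card (S - {s}))" using card_Suc_Diff1[OF fin(2) s] by simp
        have "q \<le> card S + 1"
        proof (cases "3 \<le> q")
          case True
          have "q - 2 \<le> (q - 2) * (p + 1)" by simp
          moreover have "(q - 2) * (p + 1) + 2 \<le> card S + 1"
            using q3 cardK[OF True] less.prems(8) by simp
          ultimately show ?thesis by linarith
        qed (use cS in linarith)
        then obtain l where k: "k = Suc l" using less.prems(10) by (cases k) auto
        have step: "solvable N l C'"
          if C': "C' \<subseteq> C" "\<And>c c'. c \<in> C' \<Longrightarrow> c' \<in> C' \<Longrightarrow> (c x = c s) = (c' x = c' s)" for C'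
        proof (rule less.hyps[of "S - {s}" "insert s K" C' p q])
          fix c c' b assume "c \<in> C'" "c' \<in> C'" "b \<in> {1..N} - insert s K - (S - {s})"
          then show "c b = c' b" using less.prems(4) C'(1) by blast
        next
          fix c c' a b assume c: "c \<in> C'" "c' \<in> C'" and ab: "a \<in> insert s K" "b \<in> insert s K"
          have "(c x = c a) = (c' x = c' a)" if "a \<in> insert s K" for a
            using that less.prems(5)[of c c' x a] x C' c by blast
          from this[OF ab(1)] this[OF ab(2)] show "(c a = c b) = (c' a = c' b)"
            by (metis color.exhaust)
        next
          fix c assume "c \<in> C'"
          moreover have "insert s K \<union> (S - {s}) = K \<union> S" using s by blast
          ultimately show "card {b \<in> insert s K \<union> (S - {s}). c b = Green} \<le> p"
            using less.prems(6) C'(1) by auto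
        next
          fix c v assume "c \<in> C'" and q: "3 \<le> q"
          have "card {b \<in> insert s K. c b = v} \<le> card (insert s {b \<in> K. c b = v})"
            using fin by (intro card_mono) auto
          also have "\<dots> \<le> Suc (card {b \<in> K. c b = v})" by (rule card_insert_le_m1) auto
          also have "\<dots> \<le> p + 1" using class_le[of c v] \<open>c \<in> C'\<close> q C'(1) by auto
          finally show "card {b \<in> insert s K. c b = v} \<le> p + 1" .
        next
          have "card (insert s K) = Suc (card K)" using fin s less.prems(2) by (subst card_insert_disjoint) auto
          then show "q * (p + 1) \<le> card (insert s K) + card (S - {s}) + 1" using less.prems(8) cS by simp
        qed (use s cS k less.prems(1,2,9,10) in auto)
        show ?thesis
          unfolding k using x s less.prems(1,2)
          by (intro solvable_compare[of x N s] step) auto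
      qed
    qed
  qed
qed

text \<open>The quotient is at least \<open>2\<close> because \<open>2 * p < N\<close>, so the construction can start with ball \<open>1\<close> as
  its first component.\<close>

lemma solves_upper:
  assumes "2 * p < N"
  shows "\<exists>t. solves N p (N + 1 - (N + 1) div (p + 1)) t"
proof -
  define q where "q = (N + 1) div (p + 1)"
  have q2: "2 \<le> q" unfolding q_def using assms by (simp add: less_eq_div_iff_mult_less_eq)
  have qN: "q * (p + 1) \<le> N + 1" unfolding q_def by (rule div_times_less_eq_dividend)
  have "solvable N (N + 1 - q) {c. majored N p c}"
  proof (rule solvable_growing_component[where K = "{1}" and S = "{2..N}" and p = p and q = q])
    have U: "{1} \<union> {2..N} = {1..N}" using assms by auto
    show "{1} \<union> {2..N} \<subseteq> {1..N}" using U by simp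
    fix c :: "nat \<Rightarrow> color"
    assume "c \<in> {c. majored N p c}"
    then show "card {b \<in> {1} \<union> {2..N}. c b = Green} \<le> p"
      unfolding U majored_def green_balls_def by simp
  next
    fix c :: "nat \<Rightarrow> color" and v
    have "card {b \<in> {1::nat}. c b = v} \<le> card {1::nat}" by (intro card_mono) auto
    then show "card {b \<in> {1}. c b = v} \<le> p + 1" by simp
  qed (use q2 qN assms in auto)
  then show ?thesis unfolding solvable_def solves_def q_def by blast
qed

lemma Q_bounds:
  assumes "2 * p < N"
  shows "\<exists>t. solves N p (Q N p) t" "Q N p \<le> N + 1 - (N + 1) div (p + 1)"
proof -
  show "\<exists>t. solves N p (Q N p) t"
    unfolding Q_def by (rule LeastI[of "\<lambda>k. \<exists>t. solves N p k t"]) (rule solves_upper[OF assms])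
  show "Q N p \<le> N + 1 - (N + 1) div (p + 1)"
    unfolding Q_def by (rule Least_le) (rule solves_upper[OF assms])
qed

theorem theorem2:
  fixes N p :: nat
  assumes "real p < real N / 2"
  shows "N - \<lfloor>real N / real (p + 1)\<rfloor> \<le> int (Q N p)
       \<and> int (Q N p) \<le> N + 1 - \<lfloor>real (N + 1) / real (p + 1)\<rfloor>
       \<and> (\<forall>r::nat. [N = r] (mod (p + 1)) \<and> (r = p \<or> int r \<le> \<lfloor>real p / 2\<rfloor>)
             \<longrightarrow> int (Q N p) = N + 1 - \<lfloor>real (N + 1) / real (p + 1)\<rfloor>)"
proof -
  have pN: "2 * p < N" using assms by linarith
  obtain t where t: "solves N p (Q N p) t" using Q_bounds(1)[OF pN] by blast
  have le: "N div (p + 1) \<le> N" "(N + 1) div (p + 1) \<le> N + 1" by (rule div_le_dividend)+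
  have lower: "N - N div (p + 1) \<le> Q N p" using solves_lower[OF pN t] .
  have upper: "Q N p \<le> N + 1 - (N + 1) div (p + 1)" using Q_bounds(2)[OF pN] .
  have sharp: "N + 1 - (N + 1) div (p + 1) \<le> Q N p"
    if r: "[N = r] (mod (p + 1))" "r = p \<or> int r \<le> \<lfloor>real p / 2\<rfloor>" for r
  proof -
    have "r \<le> p" using r(2) by linarith
    then have Nr: "N mod (p + 1) = r" using r(1) by (simp add: cong_def)
    show ?thesis
    proof (cases "r = p")
      case True
      then have "(N + 1) div (p + 1) = N div (p + 1) + 1"
        using Nr div_Suc[of N "p + 1"] mod_Suc[of N "p + 1"] by simp
      then show ?thesis using lower by simp
    next
      case False
      then have "2 * r \<le> p" using r(2) by linarith
      moreover have "(N + 1) div (p + 1) = N div (p + 1)"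
        using Nr False div_Suc[of N "p + 1"] mod_Suc[of N "p + 1"] by simp
      ultimately show ?thesis
        using solves_lower_small_remainder[OF pN t] Nr False \<open>r \<le> p\<close> by simp
    qed
  qed
  have fl: "\<lfloor>real N / real (p + 1)\<rfloor> = int (N div (p + 1))"
    "\<lfloor>real (N + 1) / real (p + 1)\<rfloor> = int ((N + 1) div (p + 1))"
    by (rule floor_divide_of_nat_eq)+
  have "int N - int (N div (p + 1)) \<le> int (Q N p)" using lower by linarith
  moreover have "int (Q N p) \<le> int (N + 1) - int ((N + 1) div (p + 1))" using upper le by linarith
  moreover have "int (Q N p) = int (N + 1) - int ((N + 1) div (p + 1))"
    if "[N = r] (mod (p + 1))" "r = p \<or> int r \<le> \<lfloor>real p / 2\<rfloor>" for r
    using sharp[OF that] upper le by linarith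
  ultimately show ?thesis unfolding fl by blast
qed

end
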